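(* For $n$ odd, the cycle $C_n$ on $n$ vertices satisfies \[ \overline{\mathrm{scs}}(C_n)=n-2. \]
   Context: $[k]=\{1,\dots,k\}$ and $\chi(G)$ is the chromatic number of a graph $G=(V,E)$. For a proper vertex coloring $c:V\to[\chi(G)]$, a determining set for $(G,c)$ is a set $S\subseteq V$ such that for every proper vertex coloring $c':V\to[\chi(G)]$ of $G$, if $c'|_S=c|_S$ then $c'=c$ on all of $V$. A critical set for $(G,c)$ is a determining set for $(G,c)$ that is minimal under inclusion. Define $\mathrm{scs}(G,c)=\min\{|X| : X \text{ is a critical set for } (G,c)\}$ and $\overline{\mathrm{scs}}(G)=\max_c \mathrm{scs}(G,c)$, where the maximum is over all proper colorings $c:V\to[\chi(G)]$.
   Formalization: The formal theorem assumes n odd and n > 3, because the claim fails for n = 3: every critical set of the 3-coloring of C_3 has size 2, not n − 2 = 1 (and n = 1 gives no simple cycle). *)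

theory Defs
  imports Main "HOL-Library.FuncSet"
begin

text \<open>A graph is given by its vertex set \<open>V\<close> and its set \<open>E\<close> of edges, which are two-element subsets of \<open>V\<close>.\<close>

definition simple_graph :: "'a set \<Rightarrow> 'a set set \<Rightarrow> bool" where
  "simple_graph V E \<longleftrightarrow> finite V \<and> (\<forall>e\<in>E. e \<subseteq> V \<and> card e = 2)"

text \<open>Colorings are extensional functions, so that two colorings are equal iff they agree on \<open>V\<close>.\<close>

definition proper_colorings :: "'a set \<Rightarrow> 'a set set \<Rightarrow> nat \<Rightarrow> ('a \<Rightarrow> nat) set" where
  "proper_colorings V E k =
    {c \<in> V \<rightarrow>\<^sub>E {1..k}. \<forall>u\<in>V. \<forall>v\<in>V. {u, v} \<in> E \<longrightarrow> c u \<noteq> c v}"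

definition chromatic_number :: "'a set \<Rightarrow> 'a set set \<Rightarrow> nat" where
  "chromatic_number V E = (LEAST k. proper_colorings V E k \<noteq> {})"

abbreviation optimal_colorings :: "'a set \<Rightarrow> 'a set set \<Rightarrow> ('a \<Rightarrow> nat) set" where
  "optimal_colorings V E \<equiv> proper_colorings V E (chromatic_number V E)"

definition determining_set :: "'a set \<Rightarrow> 'a set set \<Rightarrow> ('a \<Rightarrow> nat) \<Rightarrow> 'a set \<Rightarrow> bool" where
  "determining_set V E c S \<longleftrightarrow>
    S \<subseteq> V \<and> (\<forall>c'\<in>optimal_colorings V E. (\<forall>v\<in>S. c' v = c v) \<longrightarrow> (\<forall>v\<in>V. c' v = c v))"

definition critical_set :: "'a set \<Rightarrow> 'a set set \<Rightarrow> ('a \<Rightarrow> nat) \<Rightarrow> 'a set \<Rightarrow> bool" where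
  "critical_set V E c S \<longleftrightarrow>
    determining_set V E c S \<and> (\<forall>T. T \<subset> S \<longrightarrow> \<not> determining_set V E c T)"

definition scs :: "'a set \<Rightarrow> 'a set set \<Rightarrow> ('a \<Rightarrow> nat) \<Rightarrow> nat" where
  "scs V E c = Min {card X | X. critical_set V E c X}"

definition scs_bar :: "'a set \<Rightarrow> 'a set set \<Rightarrow> nat" where
  "scs_bar V E = Max {scs V E c | c. c \<in> optimal_colorings V E}"

text \<open>The cycle on \<open>n\<close> vertices; it is a simple graph for \<open>n \<ge> 3\<close>.\<close>

definition cycle_verts :: "nat \<Rightarrow> nat set" where
  "cycle_verts n = {0..<n}"

definition cycle_edges :: "nat \<Rightarrow> nat set set" where
  "cycle_edges n = {{i, (i + 1) mod n} | i. i < n}"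

lemma simple_graph_cycle:
  assumes "n \<ge> 3"
  shows "simple_graph (cycle_verts n) (cycle_edges n)"
  using assms
  by (auto simp: simple_graph_def cycle_verts_def cycle_edges_def card_insert_if mod_Suc)

end

theory Submission
  imports Defs
begin

text \<open>
  A vertex whose neighbours have different colors is determined, in a 3-coloring, by its neighbours.
  If every second vertex of the path \<open>j+1, \<dots>, j+n\<close> had equally colored neighbours, then the
  adjacent vertices \<open>j+1\<close> and \<open>j+n \<equiv> j\<close> would have the same color. Hence there is always a vertex
  with differently colored neighbours among these, and moving \<open>j\<close> gives two non-adjacent ones, whose
  complement is determining. Conversely, in the coloring \<open>1,2,1,2,\<dots>,1,2,3\<close> the \<open>n-3\<close> vertices with
  equally colored neighbours lie in every determining set but do not suffice.
\<close>

section \<open>Critical and determining sets in a finite graph\<close>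

lemma critical_subset_exists:
  assumes "finite V" "determining_set V E c S"
  shows "\<exists>X\<subseteq>S. critical_set V E c X"
proof -
  have "finite S"
    using assms finite_subset unfolding determining_set_def by blast
  then show ?thesis
    using assms(2)
  proof (induction S rule: finite_psubset_induct)
    case (psubset S)
    then show ?case
      unfolding critical_set_def by (metis order.refl psubset_imp_subset subset_trans)
  qed
qed

lemma finite_critical_cards: "finite V \<Longrightarrow> finite {card X | X. critical_set V E c X}"
  by (rule finite_subset[of _ "card ` Pow V"]) (auto simp: critical_set_def determining_set_def)

text \<open>Every determining set contains a critical one and every critical set is determining.
  Hence this lemma and \<open>scs_geI\<close> let both bounds on \<open>scs\<close> be proved with
  determining sets, without checking minimality.\<close>

lemma scs_le_card_determining:
  assumes "finite V" "determining_set V E c S"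
  shows "scs V E c \<le> card S"
proof -
  obtain X where X: "X \<subseteq> S" "critical_set V E c X"
    using critical_subset_exists[OF assms] by blast
  have "finite S"
    using assms finite_subset unfolding determining_set_def by blast
  moreover have "scs V E c \<le> card X"
    unfolding scs_def using X(2) finite_critical_cards[OF assms(1)] by (intro Min_le) auto
  ultimately show ?thesis
    using X(1) card_mono le_trans by blast
qed

lemma scs_geI:
  assumes "finite V" "\<And>S. determining_set V E c S \<Longrightarrow> m \<le> card S"
  shows "m \<le> scs V E c"
proof -
  \<comment> \<open>This makes the set of cardinalities nonempty, as \<open>Min\<close>
    requires.\<close>
  have "determining_set V E c V"
    by (simp add: determining_set_def)
  then obtain X where "critical_set V E c X"
    using critical_subset_exists[OF assms(1)] by blast
  then show ?thesis
    unfolding scs_def using finite_critical_cards[OF assms(1)] assms(2)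
    by (subst Min_ge_iff) (auto simp: critical_set_def)
qed

section \<open>Proper colorings of the cycle\<close>

lemma proper_colorings_cycle_iff:
  assumes "n > 0"
  shows "c \<in> proper_colorings (cycle_verts n) (cycle_edges n) k \<longleftrightarrow>
    c \<in> {0..<n} \<rightarrow>\<^sub>E {1..k} \<and> (\<forall>i. Suc i < n \<longrightarrow> c i \<noteq> c (Suc i)) \<and> c (n - 1) \<noteq> c 0"
    (is "?L \<longleftrightarrow> ?R")
proof
  assume L: ?L
  have ne: "c i \<noteq> c ((i + 1) mod n)" if "i < n" for i
  proof -
    have "{i, (i + 1) mod n} \<in> cycle_edges n"
      using that by (auto simp: cycle_edges_def)
    then show ?thesis
      using L that by (auto simp: proper_colorings_def cycle_verts_def)
  qed
  have "c i \<noteq> c (Suc i)" if "Suc i < n" for i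
    using ne[of i] that by simp
  moreover have "c (n - 1) \<noteq> c 0"
    using ne[of "n - 1"] assms by simp
  ultimately show ?R
    using L by (auto simp: proper_colorings_def cycle_verts_def)
next
  assume R: ?R
  have ne: "c i \<noteq> c ((i + 1) mod n)" if "i < n" for i
  proof (cases "Suc i = n")
    case True
    then have "i = n - 1" by simp
    then show ?thesis using R True by simp
  next
    case False
    then show ?thesis using R that by simp
  qed
  have "c u \<noteq> c v" if edge: "{u, v} \<in> cycle_edges n" for u v
  proof -
    obtain i where "i < n" "{u, v} = {i, (i + 1) mod n}"
      using edge by (auto simp: cycle_edges_def)
    then show ?thesis
      using ne[of i] by (auto simp: doubleton_eq_iff)
  qed
  then show ?L
    using R by (auto simp: proper_colorings_def cycle_verts_def)
qed

text \<open>Reading indices modulo \<open>n\<close> turns a coloring into an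
  \<open>n\<close>-periodic function on the naturals, so the closing edge looks like any
  other.\<close>

lemma proper_cycle_mod:
  assumes "c \<in> proper_colorings (cycle_verts n) (cycle_edges n) k" "n > 0"
  shows "c (i mod n) \<noteq> c (Suc i mod n)" "c (i mod n) \<in> {1..k}"
proof -
  have *: "c \<in> {0..<n} \<rightarrow>\<^sub>E {1..k}" "\<And>i. Suc i < n \<Longrightarrow> c i \<noteq> c (Suc i)" "c (n - 1) \<noteq> c 0"
    using assms by (auto simp: proper_colorings_cycle_iff)
  show "c (i mod n) \<noteq> c (Suc i mod n)"
  proof (cases "Suc (i mod n) = n")
    case True
    then have "i mod n = n - 1" by simp
    then show ?thesis using True * by (simp add: mod_Suc)
  next
    case False
    then have "Suc (i mod n) < n"
      using assms(2) by (simp add: Suc_lessI)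
    then show ?thesis using *(2)[of "i mod n"] False by (simp add: mod_Suc)
  qed
  have "i mod n \<in> {0..<n}" using assms(2) by simp
  then show "c (i mod n) \<in> {1..k}" using *(1) by blast
qed

section \<open>Vertices with differently colored neighbours\<close>

text \<open>The bound on \<open>m\<close> and the parity of \<open>n\<close> place the middle vertex
  \<open>j + 2 + 2 * m\<close> strictly between \<open>j + 1\<close> and \<open>j + n\<close>; this
  controls its position in the next lemma.\<close>

lemma exists_step2_change:
  fixes f :: "nat \<Rightarrow> 'a"
  assumes "odd n" and per: "f (j + n) = f j" and ne: "f j \<noteq> f (Suc j)"
  shows "\<exists>m. Suc (2 * m) < n \<and> f (j + 1 + 2 * m) \<noteq> f (j + 1 + 2 * m + 2)"
proof (rule ccontr)
  assume "\<not> ?thesis"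
  then have eq: "f (j + 1 + 2 * m) = f (j + 1 + 2 * m + 2)" if "Suc (2 * m) < n" for m
    using that by blast
  have "f (j + 1 + 2 * m) = f (j + 1)" if "2 * m < n" for m
    using that
  proof (induction m)
    case (Suc m)
    then show ?case using eq[of m] by (simp add: algebra_simps)
  qed simp
  moreover obtain m where "n = 2 * m + 1"
    using \<open>odd n\<close> by (elim oddE)
  ultimately have "f (j + n) = f (j + 1)"
    by (simp add: add_ac)
  with per ne show False by simp
qed

text \<open>The middle vertices are \<open>p + 1\<close> and \<open>p + d + 1\<close>; the bounds on
  \<open>d\<close> say that they are distinct and non-adjacent on the cycle.\<close>

lemma exists_two_step2_changes:
  fixes f :: "nat \<Rightarrow> 'a"
  assumes "odd n" "n > 3"
    and per: "\<And>j. f (j + n) = f j" and ne: "\<And>j. f j \<noteq> f (Suc j)"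
  shows "\<exists>p d. 2 \<le> d \<and> d + 2 \<le> n \<and> f p \<noteq> f (p + 2) \<and> f (p + d) \<noteq> f (p + d + 2)"
proof -
  note change = exists_step2_change[OF \<open>odd n\<close> per ne]
  obtain i where i: "f i \<noteq> f (i + 2)"
    using change[of 0] by blast
  obtain m where m: "Suc (2 * m) < n" "f (i + 2 + 2 * m) \<noteq> f (i + 2 + 2 * m + 2)"
    using change[of "i + 1"] by (auto simp: algebra_simps)
  obtain l where l: "Suc (2 * l) < n" "f (i + 1 + 2 * l) \<noteq> f (i + 1 + 2 * l + 2)"
    using change[of i] by blast
  \<comment> \<open>Relative to \<open>i\<close>, the even offset \<open>2 + 2 * m\<close> works
    unless it is \<open>n - 1\<close>, and the odd offset \<open>1 + 2 * l\<close> unless it is 1.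
    If both fail, the two new middle vertices are \<open>i + 2\<close> and \<open>i + n\<close>, the
    neighbours of \<open>i + 1\<close>; these are non-adjacent because \<open>n > 3\<close>.\<close>
  consider "2 * m + 4 \<le> n" | "l > 0" | "l = 0" "2 * m + 3 = n"
  proof -
    \<comment> \<open>Parity rules out \<open>2 * m + 2 = n\<close>.\<close>
    have "2 * m + 3 = n \<or> 2 * m + 4 \<le> n"
      using m(1) \<open>odd n\<close> by (elim oddE) presburger
    then show thesis using that by auto
  qed
  then show ?thesis
  proof cases
    case 1
    then show ?thesis
      using i m(2) by (intro exI[of _ i] exI[of _ "2 + 2 * m"]) (simp add: add_ac)
  next
    case 2
    have "1 + 2 * l + 2 \<le> n"
      using l(1) \<open>odd n\<close> by (elim oddE) presburger
    then show ?thesis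
      using i l(2) 2 by (intro exI[of _ i] exI[of _ "1 + 2 * l"]) (simp add: add_ac)
  next
    case 3
    then show ?thesis
      using l(2) m(2) \<open>n > 3\<close>
      by (intro exI[of _ "i + 1"] exI[of _ "2 * m + 1"]) (simp add: add_ac)
  qed
qed

lemma cycle_two_step2_changes:
  assumes "odd n" "n > 3" "c \<in> proper_colorings (cycle_verts n) (cycle_edges n) k"
  shows "\<exists>p d. 2 \<le> d \<and> d + 2 \<le> n \<and> c (p mod n) \<noteq> c ((p + 2) mod n)
    \<and> c ((p + d) mod n) \<noteq> c ((p + d + 2) mod n)"
  by (rule exists_two_step2_changes[of n "\<lambda>i. c (i mod n)"])
    (use assms proper_cycle_mod(1)[OF assms(3)] in auto)

section \<open>An extremal coloring and the chromatic number\<close>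

text \<open>For odd \<open>n > 3\<close>, only the vertices \<open>0\<close>, \<open>n - 2\<close>
  and \<open>n - 1\<close> have differently colored neighbours here.\<close>

definition alternating_coloring :: "nat \<Rightarrow> nat \<Rightarrow> nat" where
  "alternating_coloring n =
    (\<lambda>i\<in>{0..<n}. if i = n - 1 then 3 else if even i then 1 else 2)"

lemma alternating_coloring_proper:
  assumes "odd n" "n > 3"
  shows "alternating_coloring n \<in> proper_colorings (cycle_verts n) (cycle_edges n) 3"
  using assms by (auto simp: proper_colorings_cycle_iff alternating_coloring_def)

lemma chromatic_number_odd_cycle:
  assumes "odd n" "n > 3"
  shows "chromatic_number (cycle_verts n) (cycle_edges n) = 3"
  unfolding chromatic_number_def
proof (rule Least_equality)
  show "proper_colorings (cycle_verts n) (cycle_edges n) 3 \<noteq> {}"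
    using alternating_coloring_proper[OF assms] by blast
next
  fix k
  assume "proper_colorings (cycle_verts n) (cycle_edges n) k \<noteq> {}"
  then obtain c where c: "c \<in> proper_colorings (cycle_verts n) (cycle_edges n) k"
    by blast
  obtain p where p: "c (p mod n) \<noteq> c ((p + 2) mod n)"
    using cycle_two_step2_changes[OF assms c] by blast
  have "n > 0" using assms by simp
  note pr = proper_cycle_mod[OF c \<open>n > 0\<close>]
  \<comment> \<open>A vertex together with two differently colored neighbours already shows three
    colors.\<close>
  have "card {c (p mod n), c (Suc p mod n), c ((p + 2) mod n)} = 3"
    using p pr(1)[of p] pr(1)[of "Suc p"] by simp
  moreover have "card {c (p mod n), c (Suc p mod n), c ((p + 2) mod n)} \<le> card {1..k}"
    using pr(2) by (intro card_mono) auto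
  ultimately show "3 \<le> k" by simp
qed

section \<open>Upper bound for every coloring\<close>

lemma mod_neq_of_lt_add:
  fixes x y n :: nat
  assumes "x < y" "y < x + n"
  shows "x mod n \<noteq> y mod n"
proof
  assume "x mod n = y mod n"
  then have "n dvd y - x"
    using assms(1) by (metis less_imp_le mod_eq_dvd_iff_nat)
  then show False
    using assms by (auto dest: dvd_imp_le)
qed

lemma cycle_middle_determined:
  assumes "n > 0"
    and c: "c \<in> proper_colorings (cycle_verts n) (cycle_edges n) 3"
    and c': "c' \<in> proper_colorings (cycle_verts n) (cycle_edges n) 3"
    and ne: "c (p mod n) \<noteq> c ((p + 2) mod n)"
    and eq: "c' (p mod n) = c (p mod n)" "c' ((p + 2) mod n) = c ((p + 2) mod n)"
  shows "c' (Suc p mod n) = c (Suc p mod n)"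
proof -
  note C = proper_cycle_mod[OF c \<open>n > 0\<close>] and C' = proper_cycle_mod[OF c' \<open>n > 0\<close>]
  show ?thesis
    using ne eq C(1)[of p] C(1)[of "Suc p"] C'(1)[of p] C'(1)[of "Suc p"]
      C(2)[of p] C(2)[of "Suc p"] C(2)[of "p + 2"] C'(2)[of "Suc p"]
    by simp
qed

lemma scs_odd_cycle_le:
  assumes "odd n" "n > 3"
    and c: "c \<in> proper_colorings (cycle_verts n) (cycle_edges n) 3"
  shows "scs (cycle_verts n) (cycle_edges n) c \<le> n - 2"
proof -
  have "n > 0" using assms by simp
  obtain p d where d: "2 \<le> d" "d + 2 \<le> n"
    and p: "c (p mod n) \<noteq> c ((p + 2) mod n)"
    and q: "c ((p + d) mod n) \<noteq> c ((p + d + 2) mod n)"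
    using cycle_two_step2_changes[OF assms] by blast
  define a b where "a = Suc p mod n" and "b = Suc (p + d) mod n"
  define S where "S = cycle_verts n - {a, b}"
  have ab: "a < n" "b < n" "a \<noteq> b"
    using \<open>n > 0\<close> d mod_neq_of_lt_add[of "Suc p" "Suc (p + d)" n] by (auto simp: a_def b_def)
  \<comment> \<open>As \<open>a\<close> and \<open>b\<close> are non-adjacent, all their neighbours
    stay in \<open>S\<close>, so each of the two is forced independently of the other.\<close>
  have inS: "p mod n \<in> S" "(p + 2) mod n \<in> S" "(p + d) mod n \<in> S" "(p + d + 2) mod n \<in> S"
    using d \<open>n > 0\<close> mod_neq_of_lt_add[of p "Suc p" n] mod_neq_of_lt_add[of p "Suc (p + d)" n]
      mod_neq_of_lt_add[of "Suc p" "p + 2" n] mod_neq_of_lt_add[of "p + 2" "Suc (p + d)" n]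
      mod_neq_of_lt_add[of "Suc p" "p + d" n] mod_neq_of_lt_add[of "p + d" "Suc (p + d)" n]
      mod_neq_of_lt_add[of "Suc p" "p + d + 2" n]
      mod_neq_of_lt_add[of "Suc (p + d)" "p + d + 2" n]
    by (auto simp: S_def a_def b_def cycle_verts_def)
  have "determining_set (cycle_verts n) (cycle_edges n) c S"
    unfolding determining_set_def chromatic_number_odd_cycle[OF assms(1,2)]
  proof (intro conjI ballI impI)
    fix c' v
    assume c': "c' \<in> proper_colorings (cycle_verts n) (cycle_edges n) 3"
      and S: "\<forall>v\<in>S. c' v = c v" and v: "v \<in> cycle_verts n"
    have "c' a = c a" "c' b = c b"
      unfolding a_def b_def using inS S p q
      by (auto intro!: cycle_middle_determined[OF \<open>n > 0\<close> c c'])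
    then show "c' v = c v"
      using S v by (auto simp: S_def)
  qed (auto simp: S_def)
  moreover have "card S = n - 2"
    using ab by (simp add: S_def cycle_verts_def card_Diff_subset)
  ultimately show ?thesis
    using scs_le_card_determining[of "cycle_verts n"] by (metis cycle_verts_def finite_atLeastLessThan)
qed

section \<open>Lower bound from the alternating coloring\<close>

lemma scs_alternating_coloring_ge:
  assumes "odd n" "n > 3"
  shows "n - 2 \<le> scs (cycle_verts n) (cycle_edges n) (alternating_coloring n)"
proof (rule scs_geI)
  show "finite (cycle_verts n)" by (simp add: cycle_verts_def)
next
  fix S
  let ?c = "alternating_coloring n"
  assume "determining_set (cycle_verts n) (cycle_edges n) ?c S"
  then have S: "S \<subseteq> cycle_verts n"
    and det: "\<And>c' v. c' \<in> proper_colorings (cycle_verts n) (cycle_edges n) 3 \<Longrightarrow>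
      (\<And>v. v \<in> S \<Longrightarrow> c' v = ?c v) \<Longrightarrow> v \<in> cycle_verts n \<Longrightarrow> c' v = ?c v"
    unfolding determining_set_def chromatic_number_odd_cycle[OF assms] by blast+
  have "v \<in> S" if v: "v \<in> {1..n - 3}" for v
  proof (rule ccontr)
    assume "v \<notin> S"
    \<comment> \<open>The neighbours of \<open>v\<close> lie in \<open>{0..n - 2}\<close>, where
      color 3 does not occur.\<close>
    have "?c(v := 3) \<in> proper_colorings (cycle_verts n) (cycle_edges n) 3"
      using assms v by (auto simp: proper_colorings_cycle_iff alternating_coloring_def
          PiE_iff extensional_def)
    then have "(?c(v := 3)) v = ?c v"
      by (rule det) (use \<open>v \<notin> S\<close> v in \<open>auto simp: cycle_verts_def\<close>)
    then show False
      using v assms(2) by (auto simp: alternating_coloring_def split: if_splits)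
  qed
  moreover have "S \<noteq> {1..n - 3}"
  proof
    assume "S = {1..n - 3}"
    \<comment> \<open>Here \<open>i\<close> is \<open>n - 2\<close>, which therefore has color 2 and
      does not clash with the new color 1 of \<open>n - 1\<close>.\<close>
    have "odd i" if "Suc i = n - Suc 0" for i
      using that \<open>odd n\<close> by (metis diff_Suc_1 even_Suc odd_Suc_minus_one odd_pos One_nat_def)
    \<comment> \<open>The adjacent vertices \<open>0\<close> and \<open>n - 1\<close> swap their
      colors 1 and 3; their other neighbours, \<open>1\<close> and \<open>n - 2\<close>, both have
      color 2.\<close>
    then have "?c(0 := 3, n - 1 := 1) \<in> proper_colorings (cycle_verts n) (cycle_edges n) 3"
      using assms by (auto simp: proper_colorings_cycle_iff alternating_coloring_def
          PiE_iff extensional_def)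
    then have "(?c(0 := 3, n - 1 := 1)) 0 = ?c 0"
      by (rule det) (use \<open>S = {1..n - 3}\<close> assms(2) in \<open>auto simp: cycle_verts_def\<close>)
    then show False
      using assms(2) by (auto simp: alternating_coloring_def split: if_splits)
  qed
  ultimately have "{1..n - 3} \<subset> S" by blast
  then have "card {1..n - 3} < card S"
    using S by (intro psubset_card_mono) (auto simp: cycle_verts_def intro: finite_subset)
  then show "n - 2 \<le> card S" by simp
qed

text \<open>The triangle is excluded because the formula fails there: fixing one vertex leaves the
  other two colors interchangeable, so the value is 2 instead of 1.\<close>

theorem theorem8:
  fixes n :: nat
  assumes "odd n" and "n > 3"
  shows "scs_bar (cycle_verts n) (cycle_edges n) = n - 2"
  unfolding scs_bar_def chromatic_number_odd_cycle[OF assms]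
proof (rule Max_eqI)
  show "finite {scs (cycle_verts n) (cycle_edges n) c | c.
      c \<in> proper_colorings (cycle_verts n) (cycle_edges n) 3}"
    \<comment> \<open>The upper bound itself makes the set of values finite.\<close>
    by (rule finite_subset[of _ "{..n - 2}"]) (auto intro: scs_odd_cycle_le[OF assms])
next
  fix y
  assume "y \<in> {scs (cycle_verts n) (cycle_edges n) c | c.
      c \<in> proper_colorings (cycle_verts n) (cycle_edges n) 3}"
  then show "y \<le> n - 2"
    using scs_odd_cycle_le[OF assms] by blast
next
  have "scs (cycle_verts n) (cycle_edges n) (alternating_coloring n) = n - 2"
    using scs_odd_cycle_le[OF assms] scs_alternating_coloring_ge[OF assms]
      alternating_coloring_proper[OF assms] by (simp add: order_antisym)
  then show "n - 2 \<in> {scs (cycle_verts n) (cycle_edges n) c | c.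
      c \<in> proper_colorings (cycle_verts n) (cycle_edges n) 3}"
    using alternating_coloring_proper[OF assms] by force
qed

end
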